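(* Let $N:\mathbb{R}^n\to\mathbb{R}^n$ be a nilpotent morphism which is either positive or negative. Then $N$ possesses at most one fixed point.
   Context: A morphism (polynomial mapping) $N=(N_1,\dots,N_n):\mathbb{R}^n\to\mathbb{R}^n$ is given by polynomials $N_i\in\mathbb{R}[X_1,\dots,X_n]$. It is nilpotent if its Jacobi matrix $JN(X)=\left(\frac{\partial N_i}{\partial X_j}\right)$ satisfies $(JN(X))^n\equiv 0$ in the ring of $n\times n$ matrices over $\mathbb{R}[X_1,\dots,X_n]$. It is positive (resp. negative) if all non-zero coefficients of the polynomials $N_i$ are positive (resp. negative). A fixed point of $N$ is a point $x\in\mathbb{R}^n$ with $N(x)=x$. *)

theory Defs
  imports "HOL-Analysis.Analysis" "HOL-Library.Poly_Mapping"
begin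

(* A monomial is an exponent vector, so mpoly is the polynomial ring over the reals in
   variables indexed by 'n; its ring operations are the instances in Poly_Mapping, where
   multiplication is convolution. *)
type_synonym 'n mpoly = "('n \<Rightarrow>\<^sub>0 nat) \<Rightarrow>\<^sub>0 real"

definition mpoly_eval :: "'n::finite mpoly \<Rightarrow> real ^ 'n \<Rightarrow> real" where
  "mpoly_eval p x =
     (\<Sum>m\<in>Poly_Mapping.keys p.
        Poly_Mapping.lookup p m * (\<Prod>i\<in>UNIV. (x $ i) ^ Poly_Mapping.lookup m i))"

(* The exponent subtraction is truncated at 0, but the coefficient vanishes in that case. *)
definition mpoly_partial :: "'n \<Rightarrow> 'n mpoly \<Rightarrow> 'n mpoly" where
  "mpoly_partial j p =
     (\<Sum>m\<in>Poly_Mapping.keys p.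
        Poly_Mapping.single (m - Poly_Mapping.single j 1)
          (real (Poly_Mapping.lookup m j) * Poly_Mapping.lookup p m))"

lemma lookup_mpoly_partial:
  "Poly_Mapping.lookup (mpoly_partial j p) m =
     real (Suc (Poly_Mapping.lookup m j)) * Poly_Mapping.lookup p (m + Poly_Mapping.single j 1)"
proof -
  let ?s = "Poly_Mapping.single j (1::nat)"
  let ?c = "\<lambda>k. real (Poly_Mapping.lookup k j) * Poly_Mapping.lookup p k"
  have iff: "k - ?s = m \<longleftrightarrow> k = m + ?s" if "Poly_Mapping.lookup k j \<noteq> 0" for k
  proof
    assume "k - ?s = m"
    then show "k = m + ?s"
      using that by (auto intro!: poly_mapping_eqI simp: lookup_add lookup_minus lookup_single when_def)
  qed simp
  have "Poly_Mapping.lookup (mpoly_partial j p) m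
          = (\<Sum>k\<in>Poly_Mapping.keys p. if k - ?s = m then ?c k else 0)"
    by (simp add: mpoly_partial_def lookup_sum lookup_single when_def)
  also have "\<dots> = (\<Sum>k\<in>Poly_Mapping.keys p. if k = m + ?s then ?c k else 0)"
    using iff by (intro sum.cong) auto
  also have "\<dots> = ?c (m + ?s)"
    by (simp add: sum.delta in_keys_iff)
  finally show ?thesis
    by (simp add: lookup_add)
qed

definition morphism_map :: "('n::finite mpoly) ^ 'n \<Rightarrow> real ^ 'n \<Rightarrow> real ^ 'n" where
  "morphism_map N x = (\<chi> i. mpoly_eval (N $ i) x)"

definition jacobi_matrix :: "('n::finite mpoly) ^ 'n \<Rightarrow> ('n mpoly) ^ 'n ^ 'n" where
  "jacobi_matrix N = (\<chi> i j. mpoly_partial j (N $ i))"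

(* The operator ^ on this type would be the power for the componentwise product. *)
definition matrix_power :: "'a::semiring_1 ^ 'n ^ 'n \<Rightarrow> nat \<Rightarrow> 'a ^ 'n ^ 'n" where
  "matrix_power A k = ((**) A ^^ k) (mat 1)"

definition nilpotent_morphism :: "('n::finite mpoly) ^ 'n \<Rightarrow> bool" where
  "nilpotent_morphism N \<longleftrightarrow> matrix_power (jacobi_matrix N) CARD('n) = 0"

definition positive_morphism :: "('n::finite mpoly) ^ 'n \<Rightarrow> bool" where
  "positive_morphism N \<longleftrightarrow>
     (\<forall>i m. Poly_Mapping.lookup (N $ i) m \<noteq> 0 \<longrightarrow> Poly_Mapping.lookup (N $ i) m > 0)"

definition negative_morphism :: "('n::finite mpoly) ^ 'n \<Rightarrow> bool" where
  "negative_morphism N \<longleftrightarrow>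
     (\<forall>i m. Poly_Mapping.lookup (N $ i) m \<noteq> 0 \<longrightarrow> Poly_Mapping.lookup (N $ i) m < 0)"

end

theory Submission
  imports Defs
begin

text \<open>Summing the coefficients, i.e. evaluating at (1,\<dots>,1), turns the Jacobi matrix into a nilpotent real
  matrix whose entries have one sign and which has a nonzero entry wherever the Jacobi matrix has
  one. A product of such entries along a path cannot cancel in a matrix power, so the graph in
  which i points to j when N_i depends on X_j has no path of length n. Hence N is strictly
  triangular up to a permutation of the variables, and the coordinates of a fixed point are
  determined one after the other.\<close>

definition coeff_sum :: "('a \<Rightarrow>\<^sub>0 'b::comm_monoid_add) \<Rightarrow> 'b" where
  "coeff_sum p = (\<Sum>m\<in>Poly_Mapping.keys p. Poly_Mapping.lookup p m)"

lemma coeff_sum_0 [simp]: "coeff_sum 0 = 0"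
  by (simp add: coeff_sum_def)

lemma coeff_sum_single [simp]: "coeff_sum (Poly_Mapping.single m c) = c"
  by (simp add: coeff_sum_def)

lemma coeff_sum_1 [simp]: "coeff_sum (1 :: 'a::zero \<Rightarrow>\<^sub>0 'b::{comm_monoid_add, zero_neq_one}) = 1"
  by (simp flip: single_one)

lemma coeff_sum_add: "coeff_sum (p + q) = coeff_sum p + coeff_sum q"
  unfolding coeff_sum_def by (rule setsum_keys_plus_distrib) auto

lemma coeff_sum_sum: "coeff_sum (\<Sum>a\<in>A. f a) = (\<Sum>a\<in>A. coeff_sum (f a))"
  by (induction A rule: infinite_finite_induct) (simp_all add: coeff_sum_add)

lemma poly_mapping_eq_sum_single:
  "p = (\<Sum>m\<in>Poly_Mapping.keys p. Poly_Mapping.single m (Poly_Mapping.lookup p m))"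
proof (rule poly_mapping_eqI)
  fix k
  have "Poly_Mapping.lookup (\<Sum>m\<in>Poly_Mapping.keys p. Poly_Mapping.single m (Poly_Mapping.lookup p m)) k
      = (\<Sum>m\<in>Poly_Mapping.keys p. if m = k then Poly_Mapping.lookup p m else 0)"
    by (simp add: lookup_sum lookup_single when_def)
  then show "Poly_Mapping.lookup p k
      = Poly_Mapping.lookup (\<Sum>m\<in>Poly_Mapping.keys p. Poly_Mapping.single m (Poly_Mapping.lookup p m)) k"
    by (simp add: in_keys_iff)
qed

text \<open>Every pair of terms contributes the product of its coefficients to the total, no matter
  which exponents \<open>m + l\<close> coincide. Since \<open>coeff_sum\<close> thus respects sums
  and products, it commutes with matrix powers.\<close>

lemma coeff_sum_mult:
  fixes p q :: "'a::monoid_add \<Rightarrow>\<^sub>0 'b::semiring_0"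
  shows "coeff_sum (p * q) = coeff_sum p * coeff_sum q"
proof -
  have "p * q = (\<Sum>m\<in>Poly_Mapping.keys p. Poly_Mapping.single m (Poly_Mapping.lookup p m))
      * (\<Sum>l\<in>Poly_Mapping.keys q. Poly_Mapping.single l (Poly_Mapping.lookup q l))"
    by (simp flip: poly_mapping_eq_sum_single)
  also have "\<dots> = (\<Sum>m\<in>Poly_Mapping.keys p. \<Sum>l\<in>Poly_Mapping.keys q.
      Poly_Mapping.single (m + l) (Poly_Mapping.lookup p m * Poly_Mapping.lookup q l))"
    by (simp only: sum_product mult_single)
  finally have "p * q = \<dots>" .
  then show ?thesis
    by (simp add: coeff_sum_sum) (simp add: coeff_sum_def sum_product)
qed

lemma coeff_sum_matrix_power:
  fixes A :: "('a::monoid_add \<Rightarrow>\<^sub>0 'b::semiring_1) ^ 'n::finite ^ 'n"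
  shows "matrix_power (\<chi> i j. coeff_sum (A $ i $ j)) k = (\<chi> i j. coeff_sum (matrix_power A k $ i $ j))"
  by (induction k)
    (simp_all add: matrix_power_def vec_eq_iff mat_def matrix_matrix_mult_def
      coeff_sum_sum coeff_sum_mult)

text \<open>Terms of one sign cannot cancel. The factor \<open>c\<close> carries that sign, so that
  the positive and the negative case share one argument.\<close>

lemma coeff_sum_pos:
  fixes p :: "'a \<Rightarrow>\<^sub>0 real"
  assumes "\<And>m. c * Poly_Mapping.lookup p m \<ge> 0" "p \<noteq> 0" "c \<noteq> 0"
  shows "c * coeff_sum p > 0"
  unfolding coeff_sum_def sum_distrib_left
proof (rule sum_pos)
  fix m assume "m \<in> Poly_Mapping.keys p"
  then show "c * Poly_Mapping.lookup p m > 0"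
    using assms(1)[of m] assms(3) by (simp add: in_keys_iff order_less_le)
qed (use assms in auto)

text \<open>An entry of the k-th power is a sum over walks of length k. The factor
  \<open>c ^ k\<close> supplies one \<open>c\<close> per edge, so no walk contributes negatively,
  and a walk along edges of the relation contributes positively.\<close>

lemma matrix_power_sign:
  fixes B :: "real ^ 'n ^ 'n"
  assumes "\<And>i j. c * B $ i $ j \<ge> 0"
  shows "c ^ k * matrix_power B k $ i $ j \<ge> 0"
    and "(i, j) \<in> {(i, j). c * B $ i $ j > 0} ^^ k \<Longrightarrow> c ^ k * matrix_power B k $ i $ j > 0"
proof -
  have step: "c ^ Suc k * matrix_power B (Suc k) $ i $ j
      = (\<Sum>l\<in>UNIV. (c * B $ i $ l) * (c ^ k * matrix_power B k $ l $ j))" for i j k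
    by (simp add: matrix_power_def matrix_matrix_mult_def sum_distrib_left mult_ac)
  have nonneg: "c ^ k * matrix_power B k $ i $ j \<ge> 0" for i j k
  proof (induction k arbitrary: i)
    case 0
    show ?case by (simp add: matrix_power_def mat_def)
  next
    case (Suc k)
    show ?case
      unfolding step by (intro sum_nonneg mult_nonneg_nonneg[OF assms Suc.IH])
  qed
  then show "c ^ k * matrix_power B k $ i $ j \<ge> 0" .
  show "c ^ k * matrix_power B k $ i $ j > 0" if "(i, j) \<in> {(i, j). c * B $ i $ j > 0} ^^ k"
    using that
  proof (induction k arbitrary: i)
    case 0
    then show ?case by (simp add: matrix_power_def mat_def)
  next
    case (Suc k)
    then obtain l where l: "c * B $ i $ l > 0" "(l, j) \<in> {(i, j). c * B $ i $ j > 0} ^^ k"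
      by (blast elim: relpow_Suc_E2)
    have "(c * B $ i $ l) * (c ^ k * matrix_power B k $ l $ j) > 0"
      by (rule mult_pos_pos[OF l(1) Suc.IH[OF l(2)]])
    then show ?case
      unfolding step
      by (intro sum_pos2[where i = l] mult_nonneg_nonneg[OF assms nonneg]) auto
  qed
qed

text \<open>In characteristic 0, a variable whose partial derivative vanishes occurs in no monomial
  of \<open>p\<close>.\<close>

lemma mpoly_eval_cong:
  assumes "\<And>j. mpoly_partial j p \<noteq> 0 \<Longrightarrow> x $ j = y $ j"
  shows "mpoly_eval p x = mpoly_eval p y"
  unfolding mpoly_eval_def
proof (intro sum.cong prod.cong arg_cong2[where f = "(*)"] refl)
  fix m j assume m: "m \<in> Poly_Mapping.keys p"
  show "(x $ j) ^ Poly_Mapping.lookup m j = (y $ j) ^ Poly_Mapping.lookup m j"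
  proof (cases "Poly_Mapping.lookup m j = 0")
    case False
    \<comment> \<open>The truncated subtraction is exact because \<open>j\<close> has a positive
      exponent in \<open>m\<close>.\<close>
    then have "m - Poly_Mapping.single j 1 + Poly_Mapping.single j 1 = m"
      by (auto intro!: poly_mapping_eqI simp: lookup_add lookup_minus lookup_single when_def)
    then have "Poly_Mapping.lookup (mpoly_partial j p) (m - Poly_Mapping.single j 1) \<noteq> 0"
      using m by (simp add: lookup_mpoly_partial in_keys_iff del: One_nat_def)
    then have "mpoly_partial j p \<noteq> 0"
      by auto
    with assms show ?thesis by simp
  qed simp
qed

text \<open>Induction on a length that no path from \<open>i\<close> attains: paths from a successor
  of \<open>i\<close> obey a bound smaller by one, and the successors determine the value of
  \<open>N $ i\<close>.\<close>

lemma fixed_point_coordinate_unique: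
  assumes "morphism_map N x = x" "morphism_map N y = y"
    and "\<And>i j. mpoly_partial j (N $ i) \<noteq> 0 \<Longrightarrow> (i, j) \<in> R"
    and "\<And>j. (i, j) \<notin> R ^^ k"
  shows "x $ i = y $ i"
  using assms(4)
proof (induction k arbitrary: i)
  case 0
  \<comment> \<open>The empty path always exists, so this case is contradictory.\<close>
  then have "(i, i) \<notin> R ^^ 0" by blast
  then show ?case by simp
next
  case (Suc k)
  have "x $ j = y $ j" if "mpoly_partial j (N $ i) \<noteq> 0" for j
    using assms(3)[OF that] Suc.prems by (intro Suc.IH) (blast intro: relpow_Suc_I2)
  then have "mpoly_eval (N $ i) x = mpoly_eval (N $ i) y"
    by (rule mpoly_eval_cong)
  with assms(1,2) show ?case
    by (metis morphism_map_def vec_lambda_beta)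
qed

theorem mainTheorem8:
  fixes N :: "('n::finite mpoly) ^ 'n"
  assumes "nilpotent_morphism N"
    and "positive_morphism N \<or> negative_morphism N"
  shows "\<exists>\<^sub>\<le>\<^sub>1 x :: real ^ 'n. morphism_map N x = x"
proof -
  \<comment> \<open>The witness is 1 for a positive and -1 for a negative morphism.\<close>
  obtain c :: real where c: "c \<noteq> 0" and sign: "c * Poly_Mapping.lookup (N $ i) m \<ge> 0" for i m
  proof -
    have "\<exists>c::real. c \<noteq> 0 \<and> (\<forall>i m. c * Poly_Mapping.lookup (N $ i) m \<ge> 0)"
      using assms(2)
    proof
      assume "positive_morphism N"
      then have "Poly_Mapping.lookup (N $ i) m \<ge> 0" for i m
        unfolding positive_morphism_def by (metis less_eq_real_def)
      then show ?thesis by (intro exI[of _ 1]) simp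
    next
      assume "negative_morphism N"
      then have "Poly_Mapping.lookup (N $ i) m \<le> 0" for i m
        unfolding negative_morphism_def by (metis less_eq_real_def)
      then show ?thesis by (intro exI[of _ "-1"]) simp
    qed
    with that show thesis by blast
  qed
  define B :: "real ^ 'n ^ 'n" where "B = (\<chi> i j. coeff_sum (jacobi_matrix N $ i $ j))"
  have pos: "c * B $ i $ j > 0" if "mpoly_partial j (N $ i) \<noteq> 0" for i j
  proof -
    \<comment> \<open>Differentiation multiplies coefficients by natural numbers and so preserves
      their common sign.\<close>
    have "c * Poly_Mapping.lookup (mpoly_partial j (N $ i)) m \<ge> 0" for m
      using mult_nonneg_nonneg[OF of_nat_0_le_iff sign]
      by (simp add: lookup_mpoly_partial mult.left_commute del: of_nat_Suc)
    with that c show ?thesis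
      by (simp add: B_def jacobi_matrix_def coeff_sum_pos)
  qed
  have nonneg: "c * B $ i $ j \<ge> 0" for i j
    using pos[of j i] by (cases "mpoly_partial j (N $ i) = 0") (auto simp: B_def jacobi_matrix_def)
  have "matrix_power B CARD('n) = 0"
    using assms(1) by (simp add: B_def coeff_sum_matrix_power nilpotent_morphism_def vec_eq_iff)
  \<comment> \<open>A path of this length would make an entry of the zero matrix nonzero.\<close>
  then have "(i, j) \<notin> {(i, j). c * B $ i $ j > 0} ^^ CARD('n)" for i j
    using matrix_power_sign(2)[of c B i j "CARD('n)"] nonneg by auto
  then have "x = y" if "morphism_map N x = x" "morphism_map N y = y" for x y
    using fixed_point_coordinate_unique[OF that, of "{(i, j). c * B $ i $ j > 0}" _ "CARD('n)"] pos
    by (simp add: vec_eq_iff)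
  then show ?thesis
    by (intro Uniq_I) blast
qed

end
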